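(* There exists a function $f:\mathbb{N}\to[0,\infty)$ with $\lim_{k\to\infty} f(k)=0$ such that for every integer $k\ge 2$, no (possibly randomized, possibly exponential-time) online algorithm for the $k$-uniform online hypergraph matching problem is $\frac{4+f(k)}{k}$-competitive.
   Context: Online hypergraph matching (edge-arrival model): there is a ground set $I$ of offline vertices; hyperedges, each a subset of $I$, arrive one at a time in an order chosen by an adversary (the instance, i.e. the hypergraph together with the arrival order, is fixed in advance, independently of the algorithm's random choices). In the $k$-uniform version every hyperedge has exactly $k$ vertices. When a hyperedge arrives, the online algorithm must immediately and irrevocably decide whether to add it to its matching; it may add it only if it is disjoint from all previously added hyperedges. The algorithm's value $\mathrm{ALG}$ is the number of hyperedges it adds. $\mathrm{OPT}$ denotes the maximum size of a matching (set of pairwise disjoint hyperedges) in the instance. A (randomized) online algorithm is $c$-competitive if for every instance $\mathbb{E}[\mathrm{ALG}]\ge c\cdot \mathrm{OPT}$. *)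

theory Defs
  imports "HOL-Probability.Probability" "HOL-Library.Disjoint_Sets"
begin

text \<open>An instance consists of the finite ground set of offline vertices (labelled by natural
  numbers) and the list of hyperedges in order of arrival.\<close>

definition uniform_instance :: "nat \<Rightarrow> nat set \<Rightarrow> nat set list \<Rightarrow> bool" where
  "uniform_instance k I es \<longleftrightarrow>
     finite I \<and> distinct es \<and> (\<forall>e\<in>set es. e \<subseteq> I \<and> card e = k)"

definition OPT :: "nat set list \<Rightarrow> nat" where
  "OPT es = Max (card ` {S. S \<subseteq> set es \<and> disjoint S})"

text \<open>\<open>A I past e\<close> tells whether the algorithm adds the arriving hyperedge \<open>e\<close>, knowing the
  ground set \<open>I\<close> and the list \<open>past\<close> of hyperedges that arrived earlier. The algorithm's own
  earlier decisions are a function of \<open>I\<close> and \<open>past\<close>.\<close>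

type_synonym decision_rule = "nat set \<Rightarrow> nat set list \<Rightarrow> nat set \<Rightarrow> bool"

definition accepted :: "decision_rule \<Rightarrow> nat set \<Rightarrow> nat set list \<Rightarrow> nat set set" where
  "accepted A I es = {es ! i | i. i < length es \<and> A I (take i es) (es ! i)}"

definition ALG :: "decision_rule \<Rightarrow> nat set \<Rightarrow> nat set list \<Rightarrow> nat" where
  "ALG A I es = card (accepted A I es)"

text \<open>Prefixes of instances are instances, so disjointness of the accepted hyperedges on every
  instance says that a hyperedge is only ever added if it is disjoint from all those added before.\<close>

definition det_online_algorithm :: "nat \<Rightarrow> decision_rule \<Rightarrow> bool" where
  "det_online_algorithm k A \<longleftrightarrow>
     (\<forall>I es. uniform_instance k I es \<longrightarrow> disjoint (accepted A I es))"

text \<open>A randomized algorithm is a probability distribution over deterministic ones, such that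
  every single decision is an event.\<close>

definition randomized_online_algorithm :: "nat \<Rightarrow> decision_rule measure \<Rightarrow> bool" where
  "randomized_online_algorithm k M \<longleftrightarrow>
     prob_space M \<and>
     (\<forall>A\<in>space M. det_online_algorithm k A) \<and>
     (\<forall>I past e. uniform_instance k I (past @ [e]) \<longrightarrow> {A \<in> space M. A I past e} \<in> sets M)"

definition competitive :: "nat \<Rightarrow> real \<Rightarrow> decision_rule measure \<Rightarrow> bool" where
  "competitive k c M \<longleftrightarrow>
     (\<forall>I es. uniform_instance k I es \<longrightarrow>
        (\<integral>A. real (ALG A I es) \<partial>M) \<ge> c * real (OPT es))"

end

theory Submission imports Defs begin

text \<open>
  By averaging over a random instance, we show that even ratio \<open>4 / k\<close> is out of reach. The
  instance has \<open>k\<close> rounds with two hyperedges each. A fair coin, not visible in the round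
  itself, declares one of the two to be blocking: it meets every hyperedge of every later round,
  whereas the other one avoids all later non-blocking hyperedges. So the non-blocking hyperedges
  form a matching of size \<open>k\<close>. An algorithm adds at most one blocking hyperedge, and by symmetry it
  adds as many non-blocking as blocking ones in expectation, hence at most \<open>2\<close> in total.
\<close>

text \<open>The vertex \<open>(i, c, l)\<close> belongs to hyperedge \<open>c\<close> of round \<open>i\<close>; for \<open>l > i\<close> it is reserved for
  being hit in round \<open>l\<close>. The coins are given by the set \<open>s\<close>: the blocking hyperedge of
  round \<open>i\<close> is the one with \<open>c = (i \<in> s)\<close>.\<close>

definition hedge :: "nat \<Rightarrow> nat set \<Rightarrow> nat \<Rightarrow> bool \<Rightarrow> nat set" where
  "hedge k s j b = to_nat ` ((\<lambda>i. (i, i \<in> s, j)) ` {..<j} \<union> (\<lambda>l. (j, b, l)) ` {j..<k})"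

definition ground :: "nat \<Rightarrow> nat set" where
  "ground k = to_nat ` ({..<k} \<times> (UNIV :: bool set) \<times> {..<k})"

text \<open>The two hyperedges of a round arrive in an order fixed by their labels, so the order
  reveals nothing about the coin.\<close>

primrec rounds :: "nat \<Rightarrow> nat set \<Rightarrow> nat \<Rightarrow> nat set list" where
  "rounds k s 0 = []"
| "rounds k s (Suc j) = rounds k s j @ [hedge k s j False, hedge k s j True]"

definition accepts :: "decision_rule \<Rightarrow> nat \<Rightarrow> nat set \<Rightarrow> nat \<Rightarrow> bool \<Rightarrow> bool" where
  "accepts A k s j b \<longleftrightarrow>
     A (ground k) (rounds k s j @ (if b then [hedge k s j False] else [])) (hedge k s j b)"

section \<open>Hyperedges of the instance and its validity\<close>

lemma hedge_cong:
  assumes "\<And>i. i < j \<Longrightarrow> i \<in> s \<longleftrightarrow> i \<in> t"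
  shows "hedge k s j b = hedge k t j b"
proof -
  have "(\<lambda>i. (i, i \<in> s, j)) ` {..<j} = (\<lambda>i. (i, i \<in> t, j)) ` {..<j}"
    using assms by (intro image_cong) auto
  then show ?thesis by (simp add: hedge_def)
qed

lemma rounds_cong:
  assumes "\<And>i. i < j \<Longrightarrow> i \<in> s \<longleftrightarrow> i \<in> t"
  shows "rounds k s j = rounds k t j"
  using assms by (induction j) (auto intro!: hedge_cong)

text \<open>Coin \<open>j\<close> first matters in round \<open>j + 1\<close>: both hyperedges of
  round \<open>j\<close> get their own vertices by label and hit earlier rounds according to earlier
  coins only.\<close>

lemma accepts_cong:
  assumes "\<And>i. i < j \<Longrightarrow> i \<in> s \<longleftrightarrow> i \<in> t"
  shows "accepts A k s j b = accepts A k t j b"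
proof -
  have "rounds k s j = rounds k t j" "hedge k s j c = hedge k t j c" for c
    using rounds_cong[OF assms] hedge_cong[OF assms] by simp_all
  then show ?thesis by (simp add: accepts_def)
qed

lemma to_nat_in_hedge:
  "to_nat (i, c, l) \<in> hedge k s j b \<longleftrightarrow>
     (i < j \<and> c = (i \<in> s) \<and> l = j) \<or> (i = j \<and> c = b \<and> j \<le> l \<and> l < k)"
  unfolding hedge_def by (auto simp: inj_image_mem_iff)

lemma hedge_inject:
  assumes "j < k" "hedge k s j b = hedge k s l c"
  shows "j = l \<and> b = c"
proof -
  \<comment> \<open>This vertex is private to its hyperedge: the vertices hit in earlier rounds have
    first coordinate strictly below the third.\<close>
  have "to_nat (j, b, j) \<in> hedge k s l c"
    using assms by (simp flip: assms(2) add: to_nat_in_hedge)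
  then show ?thesis
    by (auto simp: to_nat_in_hedge)
qed

lemma card_hedge:
  assumes "j < k"
  shows "card (hedge k s j b) = k"
proof -
  have "card ((\<lambda>i. (i, i \<in> s, j)) ` {..<j} \<union> (\<lambda>l. (j, b, l)) ` {j..<k}) = j + (k - j)"
    by (subst card_Un_disjoint) (auto simp: card_image inj_on_def)
  then show ?thesis
    using assms by (simp add: hedge_def card_image)
qed

lemma hedge_subset_ground: "j < k \<Longrightarrow> hedge k s j b \<subseteq> ground k"
  unfolding hedge_def ground_def by (rule image_mono) auto

lemma set_rounds: "set (rounds k s n) = {hedge k s j b | j b. j < n}"
proof (induction n)
  case (Suc n)
  have "set (rounds k s (Suc n)) = {hedge k s j b | j b. j < n} \<union> {hedge k s n b | b. True}"
    using Suc by (auto simp: ex_bool_eq)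
  then show ?case
    by (auto simp: less_Suc_eq)
qed simp

lemma distinct_rounds: "n \<le> k \<Longrightarrow> distinct (rounds k s n)"
proof (induction n)
  case (Suc n)
  then have "hedge k s n b \<noteq> hedge k s j c" if "j \<noteq> n \<or> b \<noteq> c" for j b c
    using that hedge_inject[of n k s b j c] by auto
  then show ?case
    using Suc by (auto simp: set_rounds)
qed simp

lemma uniform_instance_rounds: "uniform_instance k (ground k) (rounds k s k)"
  unfolding uniform_instance_def
  using hedge_subset_ground[of _ k s] distinct_rounds[of k k s]
  by (auto simp: set_rounds card_hedge) (auto simp: ground_def)

section \<open>Accepted hyperedges and the offline optimum\<close>

lemma accepted_append_single:
  "accepted A I (xs @ [x]) = accepted A I xs \<union> (if A I xs x then {x} else {})"
proof -
  have image: "accepted A I ys = (!) ys ` {i \<in> {..<length ys}. A I (take i ys) (ys ! i)}" for ys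
    by (auto simp: accepted_def)
  have "{i \<in> {..<length (xs @ [x])}. A I (take i (xs @ [x])) ((xs @ [x]) ! i)} =
      {i \<in> {..<length xs}. A I (take i xs) (xs ! i)} \<union> (if A I xs x then {length xs} else {})"
    by (auto simp: nth_append less_Suc_eq)
  moreover have "(!) (xs @ [x]) ` {i \<in> {..<length xs}. A I (take i xs) (xs ! i)} =
      (!) xs ` {i \<in> {..<length xs}. A I (take i xs) (xs ! i)}"
    by (intro image_cong) (auto simp: nth_append)
  ultimately show ?thesis
    unfolding image by (simp add: image_Un)
qed

lemma accepted_rounds:
  "accepted A (ground k) (rounds k s n) = {hedge k s j b | j b. j < n \<and> accepts A k s j b}"
proof (induction n)
  case 0
  then show ?case by (simp add: accepted_def)
next
  case (Suc n)
  \<comment> \<open>Splitting the round into single arrivals produces exactly the two pasts in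
    \<open>accepts\<close>; the second contains the first hyperedge.\<close>
  have "rounds k s (Suc n) = (rounds k s n @ [hedge k s n False]) @ [hedge k s n True]"
    by simp
  then have "accepted A (ground k) (rounds k s (Suc n)) =
      {hedge k s j b | j b. j < n \<and> accepts A k s j b} \<union>
      (if accepts A k s n False then {hedge k s n False} else {}) \<union>
      (if accepts A k s n True then {hedge k s n True} else {})"
    by (simp only: accepted_append_single Suc accepts_def if_True if_False append_Nil2)
  also have "\<dots> = {hedge k s j b | j b. j < n \<and> accepts A k s j b} \<union>
      {hedge k s n b | b. accepts A k s n b}"
    by (auto simp: ex_bool_eq)
  finally show ?case
    by (auto simp: less_Suc_eq)
qed

lemma OPT_rounds: "k \<le> OPT (rounds k s k)"
proof -
  define S where "S = (\<lambda>j. hedge k s j (j \<notin> s)) ` {..<k}"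
  \<comment> \<open>Own vertices of different rounds differ in the first coordinate, and hit
    vertices in the third. An own vertex carries the non-blocking label of its round, a hit vertex
    the blocking one.\<close>
  have no_vertex: "\<not> (to_nat v \<in> hedge k s j (j \<notin> s) \<and> to_nat v \<in> hedge k s l (l \<notin> s))"
    if "j \<noteq> l" for j l and v :: "nat \<times> bool \<times> nat"
    using that by (cases v) (auto simp: to_nat_in_hedge)
  have "hedge k s j (j \<notin> s) \<inter> hedge k s l (l \<notin> s) = {}" if "j \<noteq> l" for j l
  proof (rule ccontr)
    assume "hedge k s j (j \<notin> s) \<inter> hedge k s l (l \<notin> s) \<noteq> {}"
    then obtain x where x: "x \<in> hedge k s j (j \<notin> s)" "x \<in> hedge k s l (l \<notin> s)"
      by blast
    then obtain v :: "nat \<times> bool \<times> nat" where "x = to_nat v"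
      unfolding hedge_def by blast
    with x no_vertex[OF that] show False by simp
  qed
  then have "disjoint_family_on (\<lambda>j. hedge k s j (j \<notin> s)) {..<k}"
    by (simp add: disjoint_family_on_def)
  then have "disjoint S"
    unfolding S_def by (rule disjoint_family_on_disjoint_image)
  moreover have "S \<subseteq> set (rounds k s k)"
    by (auto simp: S_def set_rounds)
  ultimately have "card S \<le> OPT (rounds k s k)"
    unfolding OPT_def by (intro Max_ge) auto
  moreover have "card S = k"
    unfolding S_def by (subst card_image) (auto simp: inj_on_def dest: hedge_inject)
  ultimately show ?thesis by simp
qed

lemma accepts_blocking_unique:
  assumes "det_online_algorithm k A"
    and "j < l" "l < k" "accepts A k s j (j \<in> s)" "accepts A k s l b"
  shows False
proof -
  have "disjoint (accepted A (ground k) (rounds k s k))"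
    using assms(1) uniform_instance_rounds by (auto simp: det_online_algorithm_def)
  moreover have "hedge k s j (j \<in> s) \<in> accepted A (ground k) (rounds k s k)"
      "hedge k s l b \<in> accepted A (ground k) (rounds k s k)"
    using assms unfolding accepted_rounds by (blast intro: less_trans)+
  moreover have "hedge k s j (j \<in> s) \<noteq> hedge k s l b"
    using assms hedge_inject[of j k s "j \<in> s" l b] by auto
  ultimately have "hedge k s j (j \<in> s) \<inter> hedge k s l b = {}"
    by (auto simp: disjoint_def)
  \<comment> \<open>The blocking hyperedge of round \<open>j\<close> reserved this vertex for round
    \<open>l\<close>, where both hyperedges hit it.\<close>
  moreover have "to_nat (j, j \<in> s, l) \<in> hedge k s j (j \<in> s) \<inter> hedge k s l b"
    using assms by (simp add: to_nat_in_hedge)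
  ultimately show False by blast
qed

section \<open>Counting and averaging over the coins\<close>

lemma sum_accepts_blocking_le:
  assumes "det_online_algorithm k A"
  shows "(\<Sum>j<k. of_bool (accepts A k s j (j \<in> s)) :: nat) \<le> 1"
proof -
  have "(\<Sum>j<k. of_bool (accepts A k s j (j \<in> s)) :: nat) = card {j. j < k \<and> accepts A k s j (j \<in> s)}"
    by (simp add: sum_of_bool_eq Int_def conj_commute)
  also have "\<dots> \<le> 1"
    using accepts_blocking_unique[OF assms]
    by (auto simp: card_le_Suc0_iff_eq) (metis linorder_neqE_nat)
  finally show ?thesis .
qed

lemma ALG_rounds_le:
  "ALG A (ground k) (rounds k s k) \<le>
     (\<Sum>j<k. of_bool (accepts A k s j (j \<in> s))) + (\<Sum>j<k. of_bool (accepts A k s j (j \<notin> s)))"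
proof -
  let ?B = "{j \<in> {..<k}. accepts A k s j (j \<in> s)}" and ?C = "{j \<in> {..<k}. accepts A k s j (j \<notin> s)}"
  have "accepted A (ground k) (rounds k s k) \<subseteq>
      (\<lambda>j. hedge k s j (j \<in> s)) ` ?B \<union> (\<lambda>j. hedge k s j (j \<notin> s)) ` ?C"
  proof
    fix e assume "e \<in> accepted A (ground k) (rounds k s k)"
    then obtain j b where "e = hedge k s j b" "j < k" "accepts A k s j b"
      by (auto simp: accepted_rounds)
    then show "e \<in> (\<lambda>j. hedge k s j (j \<in> s)) ` ?B \<union> (\<lambda>j. hedge k s j (j \<notin> s)) ` ?C"
      by (cases "b = (j \<in> s)") auto
  qed
  then have "ALG A (ground k) (rounds k s k) \<le>
      card ((\<lambda>j. hedge k s j (j \<in> s)) ` ?B \<union> (\<lambda>j. hedge k s j (j \<notin> s)) ` ?C)"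
    unfolding ALG_def by (intro card_mono) auto
  also have "\<dots> \<le> card ?B + card ?C"
    by (rule order_trans[OF card_Un_le add_mono]) (auto intro: card_image_le)
  finally show ?thesis
    by (simp add: sum_of_bool_eq Int_def)
qed

text \<open>Flipping the coin of round \<open>j\<close> swaps the roles of its two hyperedges, and leaves the
  instance up to this round unchanged.\<close>

lemma sum_accepts_flip:
  assumes "j < k"
  shows "(\<Sum>s\<in>Pow {..<k}. of_bool (accepts A k s j (j \<notin> s)) :: nat) =
         (\<Sum>s\<in>Pow {..<k}. of_bool (accepts A k s j (j \<in> s)))"
proof -
  define flip where "flip s = (if j \<in> s then s - {j} else insert j s)" for s
  have flip_flip: "flip (flip s) = s" for s
    by (auto simp: flip_def)
  have flip_in: "flip s \<in> Pow {..<k}" if "s \<in> Pow {..<k}" for s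
    using that assms by (auto simp: flip_def)
  have "accepts A k (flip s) j (j \<in> flip s) = accepts A k s j (j \<notin> s)" for s
    using accepts_cong[of j "flip s" s] by (auto simp: flip_def)
  then show ?thesis
    by (intro sum.reindex_bij_witness[of _ flip flip]) (simp_all only: flip_flip flip_in)
qed

text \<open>Blocking and non-blocking acceptances balance only round by round and after summing over
  all coins, hence the exchange of sums. With at most one blocking acceptance per outcome, this
  gives the factor 2.\<close>

lemma sum_ALG_rounds_le:
  assumes "det_online_algorithm k A"
  shows "(\<Sum>s\<in>Pow {..<k}. ALG A (ground k) (rounds k s k)) \<le> 2 * card (Pow {..<k})"
proof -
  let ?b = "\<lambda>s j. of_bool (accepts A k s j (j \<in> s)) :: nat"
  let ?c = "\<lambda>s j. of_bool (accepts A k s j (j \<notin> s)) :: nat"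
  have "(\<Sum>s\<in>Pow {..<k}. \<Sum>j<k. ?c s j) = (\<Sum>j<k. \<Sum>s\<in>Pow {..<k}. ?c s j)"
    by (rule sum.swap)
  also have "\<dots> = (\<Sum>j<k. \<Sum>s\<in>Pow {..<k}. ?b s j)"
    by (intro sum.cong refl sum_accepts_flip) simp
  also have "\<dots> = (\<Sum>s\<in>Pow {..<k}. \<Sum>j<k. ?b s j)"
    by (rule sum.swap)
  finally have swap: "(\<Sum>s\<in>Pow {..<k}. \<Sum>j<k. ?c s j) = (\<Sum>s\<in>Pow {..<k}. \<Sum>j<k. ?b s j)" .
  have "(\<Sum>s\<in>Pow {..<k}. ALG A (ground k) (rounds k s k)) \<le>
      (\<Sum>s\<in>Pow {..<k}. (\<Sum>j<k. ?b s j) + (\<Sum>j<k. ?c s j))"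
    by (intro sum_mono ALG_rounds_le)
  also have "\<dots> = 2 * (\<Sum>s\<in>Pow {..<k}. \<Sum>j<k. ?b s j)"
    by (simp only: sum.distrib swap mult_2)
  also have "\<dots> \<le> 2 * (\<Sum>s\<in>Pow {..<k}. 1)"
    by (intro mult_left_mono sum_mono sum_accepts_blocking_le assms) simp
  finally show ?thesis by simp
qed

lemma not_competitive_4_div_k:
  assumes "k > 0" "randomized_online_algorithm k M"
  shows "\<not> competitive k (4 / real k) M"
proof
  assume comp: "competitive k (4 / real k) M"
  interpret prob_space M
    using assms(2) by (simp add: randomized_online_algorithm_def)
  let ?alg = "\<lambda>s A. real (ALG A (ground k) (rounds k s k))"
  have ge: "4 \<le> (\<integral>A. ?alg s A \<partial>M)" for s
  proof -
    have "4 / real k * real k \<le> 4 / real k * real (OPT (rounds k s k))"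
      using OPT_rounds by (intro mult_left_mono) auto
    also have "\<dots> \<le> (\<integral>A. ?alg s A \<partial>M)"
      using comp uniform_instance_rounds by (auto simp: competitive_def)
    finally show ?thesis
      using assms(1) by simp
  qed
  \<comment> \<open>Non-integrable functions have integral 0, so no measurability argument is needed.\<close>
  have int: "integrable M (?alg s)" for s
    using ge[of s] not_integrable_integral_eq[of M "?alg s"] by fastforce
  have "4 * real (card (Pow {..<k})) \<le> (\<Sum>s\<in>Pow {..<k}. \<integral>A. ?alg s A \<partial>M)"
    using sum_bounded_below[of "Pow {..<k}" 4 "\<lambda>s. \<integral>A. ?alg s A \<partial>M"] ge by (simp add: mult.commute)
  \<comment> \<open>With the sum over coins inside the integral, the deterministic bound applies to
    each fixed \<open>A\<close>.\<close>
  also have "\<dots> = (\<integral>A. (\<Sum>s\<in>Pow {..<k}. ?alg s A) \<partial>M)"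
    using int by (intro Bochner_Integration.integral_sum[symmetric]) auto
  also have "\<dots> \<le> 2 * real (card (Pow {..<k}))"
  proof (rule integral_le_const)
    show "AE A in M. (\<Sum>s\<in>Pow {..<k}. ?alg s A) \<le> 2 * real (card (Pow {..<k}))"
    proof (rule AE_I2)
      fix A assume "A \<in> space M"
      then have "(\<Sum>s\<in>Pow {..<k}. ALG A (ground k) (rounds k s k)) \<le> 2 * card (Pow {..<k})"
        using assms(2) by (intro sum_ALG_rounds_le) (simp add: randomized_online_algorithm_def)
      then show "(\<Sum>s\<in>Pow {..<k}. ?alg s A) \<le> 2 * real (card (Pow {..<k}))"
        by (metis of_nat_le_iff of_nat_mult of_nat_numeral of_nat_sum)
    qed
  qed (use int in auto)
  \<comment> \<open>There are \<open>2 ^ k\<close> coin outcomes, a positive number, so 4 times it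
    exceeds 2 times it.\<close>
  finally show False
    by (simp add: card_Pow)
qed

theorem theorem2:
  "\<exists>f :: nat \<Rightarrow> real.
     (\<forall>k. 0 \<le> f k) \<and> f \<longlonglongrightarrow> 0 \<and>
     (\<forall>k\<ge>2. \<not> (\<exists>M. randomized_online_algorithm k M \<and>
                      competitive k ((4 + f k) / real k) M))"
  \<comment> \<open>Ratio \<open>4 / k\<close> itself is already excluded, so the zero function
    serves as \<open>f\<close>.\<close>
  by (intro exI[of _ "\<lambda>_. 0"]) (auto simp: not_competitive_4_div_k)

end
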